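(* Let $\mathbb{Z}$ be a finite dimensional real inner product space with induced norm $\|\cdot\|$, let $\mathcal{A},\mathcal{B}:\mathbb{Z}\rightrightarrows\mathbb{Z}$ be maximal monotone, let $\mathcal{C}:\mathbb{Z}\to\mathbb{Z}$ be $\vartheta$-cocoercive with $\vartheta>0$, put $\mathcal{F}:=\mathcal{A}+\mathcal{B}+\mathcal{C}$, and assume $\mathcal{F}^{-1}(0)\neq\emptyset$. Let $\gamma\in(0,2\vartheta)$ and let $\{\lambda_k\}_{k\ge 0}\subseteq\big[0,\frac{4\vartheta-\gamma}{2\vartheta}\big]$ satisfy $\sum_{k=0}^\infty\lambda_k\big(\frac{4\vartheta-\gamma}{2\vartheta}-\lambda_k\big)=+\infty$. Let $\{x^k\},\{y^k\},\{z^k\}$ be generated from an arbitrary $x^0\in\mathbb{Z}$ by Davis' three-operator splitting method $$z^k=\mathcal{J}_{\gamma\mathcal{B}}(x^k),\qquad y^k=\mathcal{J}_{\gamma\mathcal{A}}(2z^k-x^k-\gamma\mathcal{C}z^k),\qquad x^{k+1}=x^k+\lambda_k(y^k-z^k),\qquad k\in\mathbb{N},$$ and let $\mathcal{T}:=\mathcal{I}-\mathcal{J}_{\gamma\mathcal{B}}+\mathcal{J}_{\gamma\mathcal{A}}\circ(2\mathcal{J}_{\gamma\mathcal{B}}-\mathcal{I}-\gamma\mathcal{C}\circ\mathcal{J}_{\gamma\mathcal{B}})$. Then the following hold. (a) $\{y^k\}$ and $\{z^k\}$ converge to a point $z^*\in\mathcal{F}^{-1}(0)$, $\{x^k\}$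 converges to a point $x^*\in{\rm Fix}\,\mathcal{T}$, and $$\|x^{k+1}-x\|^2\le\|x^k-x\|^2-\lambda_k\Big(\frac{4\vartheta-\gamma}{2\vartheta}-\lambda_k\Big)\|\mathcal{T}x^k-x^k\|^2\qquad\forall x\in{\rm Fix}\,\mathcal{T},\ \forall k\in\mathbb{N}.$$ (b) If $\mathcal{A}$ is single-valued and Lipschitz continuous with modulus $1/\beta$ ($\beta>0$) and $\mathcal{F}$ is metrically subregular at $(z^*,0)$ with constant $\kappa>0$, then there exists $\overline{k}\in\mathbb{N}$ such that $${\rm dist}^2(x^{k+1},{\rm Fix}\,\mathcal{T})\le(1-\varrho)\,{\rm dist}^2(x^k,{\rm Fix}\,\mathcal{T})\qquad\text{for all }k\ge\overline{k},$$ with (depending on $k$ through $\lambda_k$) $$\varrho=\frac{\lambda_k(4\vartheta-\gamma-2\vartheta\lambda_k)}{2\vartheta\big[(2+\gamma\vartheta^{-1})+(\gamma\vartheta^{-1}+\sqrt{1+\gamma^2\beta^{-2}})(1+\kappa(\gamma^{-1}+\beta^{-1}))\big]^2}.$$ (c) If $\mathcal{B}$ is single-valued and Lipschitz continuous with modulus $1/\beta$ ($\beta>0$) and $\mathcal{F}$ is metrically subregular at $(z^*,0)$ with constant $\kappa>0$, then there exists $\overline{k}\in\mathbb{N}$ such that $${\rm dist}^2(x^{k+1},{\rm Fix}\,\mathcal{T})\le(1-\varrho)\,{\rm dist}^2(x^k,{\rm Fix}\,\mathcal{T})\qquad\text{for all }k\ge\overline{k},$$ with (depending on $k$ through $\lambda_k$)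 $$\varrho=\frac{\lambda_k(4\vartheta-\gamma-2\vartheta\lambda_k)}{2\vartheta(1+\gamma\beta^{-1})^2\Big[1+\kappa\Big(\frac1\beta+\frac1\gamma\sqrt{1+\max\big(\frac{\gamma^2-2\gamma\vartheta}{\vartheta^2},0\big)}\Big)\Big]^2}.$$
   Context: For an operator $\mathcal{T}:\mathbb{Z}\rightrightarrows\mathbb{Z}$ (set-valued map) and $\gamma>0$, $\mathcal{J}_{\gamma\mathcal{T}}=(\mathcal{I}+\gamma\mathcal{T})^{-1}$ denotes its resolvent, where $\mathcal{I}$ is the identity. ${\rm gph}\,\mathcal{T}=\{(x,y): y\in\mathcal{T}(x)\}$, $\mathcal{T}^{-1}(y)=\{x: y\in\mathcal{T}(x)\}$, ${\rm Fix}\,\mathcal{T}$ is the set of fixed points of a single-valued map $\mathcal{T}$, and ${\rm dist}(x,S)=\inf_{s\in S}\|x-s\|$ (equal to $+\infty$ if $S=\emptyset$). $\mathcal{C}$ is $\vartheta$-cocoercive if $\langle x-y,\mathcal{C}x-\mathcal{C}y\rangle\ge\vartheta\|\mathcal{C}x-\mathcal{C}y\|^2$ for all $x,y\in\mathbb{Z}$. An operator $\mathcal{A}$ that is single-valued is regarded as a map $\mathbb{Z}\to\mathbb{Z}$; it is Lipschitz continuous with modulus $1/\beta$ if $\|\mathcal{A}u-\mathcal{A}v\|\le\beta^{-1}\|u-v\|$ for all $u,v$. An operator $\mathcal{T}$ is metrically subregular at $(\overline{x},\overline{y})\in{\rm gph}\,\mathcal{T}$ with constant $\kappa>0$ if there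 is a neighborhood $U$ of $\overline{x}$ such that ${\rm dist}(x,\mathcal{T}^{-1}(\overline{y}))\le\kappa\,{\rm dist}(\overline{y},\mathcal{T}x)$ for all $x\in U$. *)

theory Defs
  imports "HOL-Analysis.Analysis" "HOL-Library.Set_Algebras" "HOL-Library.Extended_Real"
begin

text \<open>A set-valued operator on a space \<open>'a\<close> is a function \<open>'a \<Rightarrow> 'a set\<close>; a single-valued map \<open>f\<close> is
  embedded as \<open>\<lambda>x. {f x}\<close>. Sums of operators use the Minkowski sum of sets.\<close>

definition gph :: "('a \<Rightarrow> 'a set) \<Rightarrow> ('a \<times> 'a) set" where
  "gph T = {(x, y). y \<in> T x}"

definition op_inverse :: "('a \<Rightarrow> 'a set) \<Rightarrow> 'a \<Rightarrow> 'a set" where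
  "op_inverse T y = {x. y \<in> T x}"

definition op_single :: "('a \<Rightarrow> 'a) \<Rightarrow> 'a \<Rightarrow> 'a set" where
  "op_single f x = {f x}"

definition op_add :: "('a::plus \<Rightarrow> 'a set) \<Rightarrow> ('a \<Rightarrow> 'a set) \<Rightarrow> 'a \<Rightarrow> 'a set" where
  "op_add S T x = S x + T x"

definition op_scale :: "real \<Rightarrow> ('a::real_vector \<Rightarrow> 'a set) \<Rightarrow> 'a \<Rightarrow> 'a set" where
  "op_scale \<gamma> T x = (\<lambda>u. \<gamma> *\<^sub>R u) ` T x"

definition monotone_op :: "('a::real_inner \<Rightarrow> 'a set) \<Rightarrow> bool" where
  "monotone_op T \<longleftrightarrow> (\<forall>(x, u) \<in> gph T. \<forall>(y, v) \<in> gph T. (x - y) \<bullet> (u - v) \<ge> 0)"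

definition maximal_monotone :: "('a::real_inner \<Rightarrow> 'a set) \<Rightarrow> bool" where
  "maximal_monotone T \<longleftrightarrow>
     monotone_op T \<and> (\<forall>S. monotone_op S \<and> gph T \<subseteq> gph S \<longrightarrow> gph S = gph T)"

definition cocoercive :: "real \<Rightarrow> ('a::real_inner \<Rightarrow> 'a) \<Rightarrow> bool" where
  "cocoercive \<theta> C \<longleftrightarrow> (\<forall>x y. (x - y) \<bullet> (C x - C y) \<ge> \<theta> * (norm (C x - C y))\<^sup>2)"

text \<open>The resolvent \<open>(I + \<gamma>T)\<inverse>\<close> is read as a function: its value at \<open>x\<close> is the unique element of
  the set-valued inverse at \<open>x\<close> (which exists if \<open>\<gamma> > 0\<close> and \<open>T\<close> is maximal monotone, by Minty's
  theorem), and is unspecified if that set is not a singleton.\<close>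

definition resolvent :: "real \<Rightarrow> ('a::real_vector \<Rightarrow> 'a set) \<Rightarrow> 'a \<Rightarrow> 'a" where
  "resolvent \<gamma> T x = the_elem (op_inverse (op_add (op_single id) (op_scale \<gamma> T)) x)"

definition Fix :: "('a \<Rightarrow> 'a) \<Rightarrow> 'a set" where
  "Fix T = {x. T x = x}"

definition davis_map ::
  "real \<Rightarrow> ('a::real_vector \<Rightarrow> 'a set) \<Rightarrow> ('a \<Rightarrow> 'a set) \<Rightarrow> ('a \<Rightarrow> 'a) \<Rightarrow> 'a \<Rightarrow> 'a" where
  "davis_map \<gamma> A B C x =
     x - resolvent \<gamma> B x
       + resolvent \<gamma> A (2 *\<^sub>R resolvent \<gamma> B x - x - \<gamma> *\<^sub>R C (resolvent \<gamma> B x))"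

text \<open>Extended-valued, with \<open>set_dist x {} = \<infinity>\<close>; the library's \<open>infdist\<close> has \<open>infdist x {} = 0\<close>, which
  would be wrong for points outside the domain of an operator in \<open>metrically_subregular\<close>.\<close>

definition set_dist :: "'a::real_normed_vector \<Rightarrow> 'a set \<Rightarrow> ereal" where
  "set_dist x S = (INF s\<in>S. ereal (norm (x - s)))"

definition metrically_subregular ::
  "('a::real_normed_vector \<Rightarrow> 'a set) \<Rightarrow> 'a \<Rightarrow> 'a \<Rightarrow> real \<Rightarrow> bool" where
  "metrically_subregular T xb yb \<kappa> \<longleftrightarrow>
     (xb, yb) \<in> gph T \<and> \<kappa> > 0 \<and>
     (\<exists>U. open U \<and> xb \<in> U \<and>
        (\<forall>x\<in>U. set_dist x (op_inverse T yb) \<le> ereal \<kappa> * set_dist yb (T x)))"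

definition single_valued_lipschitz :: "real \<Rightarrow> ('a::real_normed_vector \<Rightarrow> 'a set) \<Rightarrow> bool" where
  "single_valued_lipschitz L T \<longleftrightarrow> (\<exists>f. T = op_single f \<and> L-lipschitz_on UNIV f)"

end

theory Submission imports Defs begin

text \<open>
  Write \<open>J\<^sub>B\<close> for the resolvent of \<open>B\<close> and, for a point \<open>p\<close>, put \<open>z = J\<^sub>B p\<close> and
  \<open>y = J\<^sub>A (2z - p - \<gamma>Cz)\<close>, so that \<open>p - Tp = z - y\<close>. By Minty's theorem the resolvents are
  everywhere defined, which gives elements \<open>b = (p - z)/\<gamma>\<close> of \<open>Bz\<close> and
  \<open>a = (2z - p - \<gamma>Cz - y)/\<gamma>\<close> of \<open>Ay\<close>, with \<open>a + b + Cz = (z - y)/\<gamma>\<close>. In particular the fixed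
  points of \<open>T\<close> are exactly the points \<open>z + \<gamma>b\<close> with \<open>b \<in> Bz\<close> and \<open>-(b + Cz) \<in> Az\<close>.

  Adding the monotonicity inequalities of \<open>A\<close> and \<open>B\<close> to the cocoercivity of \<open>C\<close> and completing a
  square shows that \<open>I - T\<close> satisfies \<open>L |r|\<^sup>2 \<le> 2 \<langle>p - q, r\<rangle>\<close> for
  \<open>r = (p - Tp) - (q - Tq)\<close> and \<open>L = (4\<theta> - \<gamma>)/(2\<theta>)\<close> (\<open>residual_cocoercive\<close>). This alone
  yields, for \<open>\<lambda>\<^sub>k \<in> [0, L]\<close>, the Fejer inequality, the monotone decrease of \<open>|Tx\<^sub>k - x\<^sub>k|\<close> and, with the divergence of
  \<open>\<Sum>\<lambda>\<^sub>k(L - \<lambda>\<^sub>k)\<close>, the convergence of \<open>x\<^sub>k\<close> to a fixed point (\<open>Krasnoselskii_Mann\<close>);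
  \<open>z\<^sub>k\<close> and \<open>y\<^sub>k\<close> follow by continuity of \<open>J\<^sub>B\<close> and \<open>T\<close>.

  For the linear rates it suffices, by the Fejer inequality at the projection of \<open>x\<^sub>k\<close> onto \<open>Fix T\<close>,
  to prove an error bound \<open>dist(p, Fix T) \<le> K |Tp - p|\<close> near the limit (\<open>error_bound_A\<close>,
  \<open>error_bound_B\<close>). If \<open>A\<close> (respectively \<open>B\<close>) is single-valued and Lipschitz, then moving \<open>a\<close> to
  \<open>Az\<close> (respectively \<open>b\<close> and \<open>Cz\<close> to \<open>By\<close> and \<open>Cy\<close>) produces an element of \<open>Fz\<close> (respectively
  \<open>Fy\<close>) of norm at most a multiple of \<open>|z - y|\<close>. Metric subregularity then supplies a zero of
  \<open>F\<close> close to \<open>z\<close> (respectively \<open>y\<close>), and the fixed point of \<open>T\<close> belonging to this zero is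
  close to \<open>p\<close>.
\<close>

section \<open>Minty's theorem and resolvents\<close>

lemma norm_diff_scaleR_square:
  fixes u v :: "'a::real_inner"
  shows "(norm (u - t *\<^sub>R v))\<^sup>2 = (norm u)\<^sup>2 - 2 * t * (u \<bullet> v) + t\<^sup>2 * (norm v)\<^sup>2"
proof -
  have "(norm (u - t *\<^sub>R v))\<^sup>2 = u \<bullet> u - t * (u \<bullet> v) - (t * (v \<bullet> u) - t * (t * (v \<bullet> v)))"
    by (simp only: power2_norm_eq_inner inner_diff_left inner_diff_right inner_scaleR_left
        inner_scaleR_right right_diff_distrib)
  also have "\<dots> = u \<bullet> u - 2 * t * (u \<bullet> v) + t\<^sup>2 * (v \<bullet> v)"
    by (simp add: inner_commute[of v u] power2_eq_square)
  finally show ?thesis by (simp only: power2_norm_eq_inner)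
qed

lemma nonneg_if_small_quadratic_nonneg:
  fixes D N :: real
  assumes "\<And>t. 0 < t \<Longrightarrow> t \<le> 1 \<Longrightarrow> 0 \<le> t * D + t\<^sup>2 * N"
  shows "0 \<le> D"
proof (rule ccontr)
  assume "\<not> 0 \<le> D"
  then have D: "D < 0" by simp
  define t where "t = - D / (\<bar>N\<bar> - D)"
  have den: "\<bar>N\<bar> - D > 0" using D by linarith
  have t: "0 < t" "t \<le> 1" using D den by (simp_all add: t_def field_simps)
  have "0 \<le> t * (D + t * N)" using assms[OF t] by (simp add: power2_eq_square algebra_simps)
  then have "0 \<le> D + t * N" using t by (simp add: zero_le_mult_iff)
  also have "t * N \<le> t * \<bar>N\<bar>" using t by (simp add: mult_left_mono)
  also have "t * \<bar>N\<bar> = - D * (\<bar>N\<bar> / (\<bar>N\<bar> - D))" by (simp add: t_def)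
  also have "\<dots> < - D * 1"
    using D den by (intro mult_strict_left_mono) (auto simp: field_simps)
  finally show False by simp
qed

text \<open>The relation \<open>R\<close> below expresses monotonicity as an inequality that is affine in each of the
  two points separately, hence it passes to convex combinations in one argument at a time.\<close>

lemma monotone_convex_hull_inner_le:
  fixes S :: "('a::euclidean_space \<times> 'a) set"
  assumes mono: "\<And>a b c d. (a, b) \<in> S \<Longrightarrow> (c, d) \<in> S \<Longrightarrow> 0 \<le> (a - c) \<bullet> (b - d)"
    and mem: "(a, b, e) \<in> convex hull ((\<lambda>(a, b). (a, b, a \<bullet> b)) ` S)"
  shows "a \<bullet> b \<le> e"
proof -
  let ?G = "(\<lambda>(a, b). (a, b, a \<bullet> b)) ` S"
  define R where "R = (\<lambda>(a::'a, b::'a, e::real) (c::'a, d::'a, f::real). 0 \<le> e + f - a \<bullet> d - c \<bullet> b)"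
  have R_convex: "convex {p. R p q}" for q
  proof (rule convexI)
    fix p p' and u v :: real
    assume "p \<in> {p. R p q}" "p' \<in> {p. R p q}" and uv: "0 \<le> u" "0 \<le> v" "u + v = 1"
    obtain a b e a' b' e' c d f where eq: "p = (a, b, e)" "p' = (a', b', e')" "q = (c, d, f)"
      by (metis prod_cases3)
    have "0 \<le> u * (e + f - a \<bullet> d - c \<bullet> b) + v * (e' + f - a' \<bullet> d - c \<bullet> b')"
      using \<open>p \<in> _\<close> \<open>p' \<in> _\<close> uv by (simp add: eq R_def)
    also have "\<dots> = u * e + v * e' + (u + v) * f - (u *\<^sub>R a + v *\<^sub>R a') \<bullet> d
                     - c \<bullet> (u *\<^sub>R b + v *\<^sub>R b')"
      by (simp add: inner_simps algebra_simps)
    finally show "u *\<^sub>R p + v *\<^sub>R p' \<in> {p. R p q}"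
      using uv by (simp add: eq R_def)
  qed
  have R_sym: "R p q \<longleftrightarrow> R q p" for p q
    by (auto simp: R_def inner_commute algebra_simps split: prod.splits)
  have R_G: "R p q" if "p \<in> ?G" "q \<in> ?G" for p q
    using that mono by (fastforce simp: R_def inner_simps inner_commute algebra_simps)
  have R_hull: "R p q" if "p \<in> convex hull ?G" "q \<in> ?G" for p q
    using hull_minimal[of ?G "{p. R p q}" convex] R_convex R_G that by blast
  have "R p q" if "p \<in> convex hull ?G" "q \<in> convex hull ?G" for p q
    using hull_minimal[of ?G "{p'. R p' q}" convex] R_convex R_hull R_sym that by blast
  from this[OF mem mem] show ?thesis by (simp add: R_def inner_commute)
qed

text \<open>The finite case of Minty's theorem. Over the convex hull of the points \<open>(a, b, a \<bullet> b)\<close>, the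
  convex function \<open>|(a - b)/2|\<^sup>2 + e\<close> of \<open>(a, b, e)\<close> has a minimizer \<open>(a0, b0, e0)\<close>, and its value there
  is nonnegative by the preceding lemma. First-order optimality along the segments to the
  generating points then says that \<open>u = (a0 - b0)/2\<close> is as required.\<close>

lemma finite_monotone_related_antidiagonal_point:
  fixes S :: "('a::euclidean_space \<times> 'a) set"
  assumes fin: "finite S"
    and mono: "\<And>a b c d. (a, b) \<in> S \<Longrightarrow> (c, d) \<in> S \<Longrightarrow> 0 \<le> (a - c) \<bullet> (b - d)"
  shows "\<exists>u. \<forall>(a, b)\<in>S. 0 \<le> (a - u) \<bullet> (b + u)"
proof (cases "S = {}")
  case False
  define H where "H = convex hull ((\<lambda>(a, b). (a, b, a \<bullet> b)) ` S)"
  define g where "g = (\<lambda>(a::'a, b, e::real). (norm ((1/2) *\<^sub>R (a - b)))\<^sup>2 + e)"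
  have "compact H" "H \<noteq> {}" using fin False by (auto simp: H_def intro: finite_imp_compact_convex_hull)
  moreover have "continuous_on H g"
    unfolding g_def case_prod_beta by (intro continuous_intros)
  ultimately obtain p where p: "p \<in> H" "\<And>q. q \<in> H \<Longrightarrow> g p \<le> g q"
    using continuous_attains_inf[of H g] by blast
  obtain a0 b0 e0 where p_eq: "p = (a0, b0, e0)" by (metis prod_cases3)
  define u where "u = (1/2) *\<^sub>R (a0 - b0)"
  have "a0 \<bullet> b0 \<le> e0"
    using monotone_convex_hull_inner_le[OF mono] p(1) unfolding H_def p_eq by blast
  moreover have "u \<bullet> u + a0 \<bullet> b0 = (norm ((1/2) *\<^sub>R (a0 + b0)))\<^sup>2"
    by (simp add: u_def power2_norm_eq_inner inner_simps inner_commute field_simps)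
  ultimately have value_nonneg: "0 \<le> u \<bullet> u + e0"
    by (metis add_left_mono order_trans zero_le_power2)
  have "0 \<le> (a - u) \<bullet> (b + u)" if ab: "(a, b) \<in> S" for a b
  proof -
    define c where "c = (1/2) *\<^sub>R (a - b)"
    have q: "(a, b, a \<bullet> b) \<in> H" using ab unfolding H_def by (intro hull_inc) force
    have "0 \<le> 2 * (u \<bullet> (c - u)) + (a \<bullet> b - e0)"
    proof (rule nonneg_if_small_quadratic_nonneg)
      fix t :: real assume t: "0 < t" "t \<le> 1"
      have "(1 - t) *\<^sub>R p + t *\<^sub>R (a, b, a \<bullet> b) \<in> H"
        using t p(1) q by (intro convexD) (auto simp: H_def convex_convex_hull)
      from p(2)[OF this]
      have "(norm u)\<^sup>2 + e0 \<le> (norm (u + t *\<^sub>R (c - u)))\<^sup>2 + ((1 - t) * e0 + t * (a \<bullet> b))"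
        by (simp add: p_eq g_def u_def c_def algebra_simps)
      moreover have "(norm (u + t *\<^sub>R (c - u)))\<^sup>2
          = (norm u)\<^sup>2 + 2 * t * (u \<bullet> (c - u)) + t\<^sup>2 * ((c - u) \<bullet> (c - u))"
        using norm_diff_scaleR_square[of u "- t" "c - u"] by (simp add: power2_norm_eq_inner)
      ultimately show "0 \<le> t * (2 * (u \<bullet> (c - u)) + (a \<bullet> b - e0)) + t\<^sup>2 * ((c - u) \<bullet> (c - u))"
        by (simp add: algebra_simps)
    qed
    with value_nonneg have "0 \<le> 2 * (u \<bullet> c) + a \<bullet> b - u \<bullet> u" by (simp add: inner_simps)
    also have "\<dots> = (a - u) \<bullet> (b + u)"
      by (simp add: c_def inner_simps inner_commute algebra_simps)
    finally show ?thesis .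
  qed
  then show ?thesis by blast
qed simp

text \<open>For each pair the admissible \<open>u\<close> form a closed ball, so compactness reduces the claim to
  finite subsets.\<close>

lemma monotone_related_antidiagonal_point:
  fixes S :: "('a::euclidean_space \<times> 'a) set"
  assumes mono: "\<And>a b c d. (a, b) \<in> S \<Longrightarrow> (c, d) \<in> S \<Longrightarrow> 0 \<le> (a - c) \<bullet> (b - d)"
  shows "\<exists>u. \<forall>(a, b)\<in>S. 0 \<le> (a - u) \<bullet> (b + u)"
proof (cases "S = {}")
  case False
  define K where "K = (\<lambda>(a::'a, b). {u. 0 \<le> (a - u) \<bullet> (b + u)})"
  have K_ball: "K (a, b) = cball ((1/2) *\<^sub>R (a - b)) (norm ((1/2) *\<^sub>R (a + b)))" for a b
  proof -
    have "(a - u) \<bullet> (b + u) = (norm ((1/2) *\<^sub>R (a + b)))\<^sup>2 - (norm ((1/2) *\<^sub>R (a - b) - u))\<^sup>2" for u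
      by (simp add: power2_norm_eq_inner inner_simps inner_commute field_simps)
    then show ?thesis by (auto simp: K_def dist_norm abs_le_square_iff[symmetric] simp del: norm_scaleR)
  qed
  have K_cl: "compact (K p)" for p by (cases p) (simp add: K_ball)
  obtain p0 where p0: "p0 \<in> S" using False by blast
  have "K p0 \<inter> \<Inter> (K ` S) \<noteq> {}"
  proof (rule compact_imp_fip[OF K_cl])
    fix F' assume "finite F'" "F' \<subseteq> K ` S"
    then obtain S' where S': "finite S'" "S' \<subseteq> S" "F' = K ` S'"
      by (meson finite_subset_image)
    have "\<exists>u. \<forall>(a, b)\<in>insert p0 S'. 0 \<le> (a - u) \<bullet> (b + u)"
      using S' p0 by (intro finite_monotone_related_antidiagonal_point mono) auto
    then show "K p0 \<inter> \<Inter> F' \<noteq> {}" using S' by (fastforce simp: K_def)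
  qed (use K_cl in \<open>auto intro: compact_imp_closed\<close>)
  then show ?thesis by (fastforce simp: K_def)
qed simp

text \<open>The pairs \<open>(a, \<gamma>b - x)\<close> are monotone whenever the pairs \<open>(a, b)\<close> are. The point \<open>u\<close> that the
  previous lemma gives for them makes \<open>(u, (x - u)/\<gamma>)\<close> monotonically related to the graph of \<open>T\<close>,
  and maximality puts it into the graph.\<close>

theorem Minty_surjective:
  fixes T :: "'a::euclidean_space \<Rightarrow> 'a set"
  assumes max: "maximal_monotone T" and \<gamma>: "0 < \<gamma>"
  shows "\<exists>u v. v \<in> T u \<and> u + \<gamma> *\<^sub>R v = x"
proof -
  have mono: "0 \<le> (a - c) \<bullet> (b - d)" if "b \<in> T a" "d \<in> T c" for a b c d
    using max that by (auto simp: maximal_monotone_def monotone_op_def gph_def)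
  define S where "S = {(a, \<gamma> *\<^sub>R b - x) | a b. b \<in> T a}"
  have "\<exists>u. \<forall>(a, b)\<in>S. 0 \<le> (a - u) \<bullet> (b + u)"
  proof (rule monotone_related_antidiagonal_point)
    fix a b c d assume "(a, b) \<in> S" "(c, d) \<in> S"
    then obtain b' d' where "b' \<in> T a" "d' \<in> T c" "b = \<gamma> *\<^sub>R b' - x" "d = \<gamma> *\<^sub>R d' - x"
      by (auto simp: S_def)
    then have "(a - c) \<bullet> (b - d) = \<gamma> * ((a - c) \<bullet> (b' - d'))"
      by (simp add: scaleR_diff_right[symmetric])
    with mono[of b' a d' c] \<open>b' \<in> T a\<close> \<open>d' \<in> T c\<close> \<gamma> show "0 \<le> (a - c) \<bullet> (b - d)" by simp
  qed
  then obtain u where u: "\<And>a b. b \<in> T a \<Longrightarrow> 0 \<le> (a - u) \<bullet> (\<gamma> *\<^sub>R b - x + u)"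
    by (fastforce simp: S_def)
  define v where "v = (1 / \<gamma>) *\<^sub>R (x - u)"
  have uv: "0 \<le> (a - u) \<bullet> (b - v)" if "b \<in> T a" for a b
  proof -
    have "\<gamma> * ((a - u) \<bullet> (b - v)) = (a - u) \<bullet> (\<gamma> *\<^sub>R b - x + u)"
      using \<gamma> by (simp add: v_def inner_simps algebra_simps)
    then have "0 \<le> \<gamma> * ((a - u) \<bullet> (b - v))" using u[OF that] by simp
    then show ?thesis using \<gamma> by (simp add: zero_le_mult_iff)
  qed
  \<comment> \<open>Add the pair \<open>(u, v)\<close> to the graph of \<open>T\<close>.\<close>
  define S' where "S' = (\<lambda>w. if w = u then insert v (T u) else T w)"
  have uv': "0 \<le> (u - a) \<bullet> (v - b)" if "b \<in> T a" for a b
    using uv[OF that] by (simp add: inner_simps algebra_simps)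
  have "monotone_op S'"
    using mono uv uv' by (auto simp: monotone_op_def gph_def S'_def split: if_splits)
  moreover have "gph T \<subseteq> gph S'" by (auto simp: gph_def S'_def)
  ultimately have "gph S' = gph T" using max by (auto simp: maximal_monotone_def)
  then have "v \<in> T u" by (auto simp: gph_def S'_def set_eq_iff split: if_splits)
  moreover have "u + \<gamma> *\<^sub>R v = x" using \<gamma> by (simp add: v_def)
  ultimately show ?thesis by blast
qed

lemma maximal_monotone_imp_monotone:
  "maximal_monotone T \<Longrightarrow> v \<in> T u \<Longrightarrow> v' \<in> T u' \<Longrightarrow> 0 \<le> (u - u') \<bullet> (v - v')"
  by (auto simp: maximal_monotone_def monotone_op_def gph_def)

lemma resolvent_eqI:
  fixes T :: "'a::euclidean_space \<Rightarrow> 'a set"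
  assumes max: "maximal_monotone T" and \<gamma>: "0 < \<gamma>" and v: "v \<in> T u"
  shows "resolvent \<gamma> T (u + \<gamma> *\<^sub>R v) = u"
proof -
  have inv: "op_inverse (op_add (op_single id) (op_scale \<gamma> T)) w = {p. \<exists>q\<in>T p. w = p + \<gamma> *\<^sub>R q}" for w
    by (auto simp: op_inverse_def op_add_def op_single_def op_scale_def set_plus_def)
  have "p = u" if "q \<in> T p" "u + \<gamma> *\<^sub>R v = p + \<gamma> *\<^sub>R q" for p q
  proof -
    have "u - p = - \<gamma> *\<^sub>R (v - q)" using that(2) by (simp add: algebra_simps)
    then have "(norm (u - p))\<^sup>2 = - \<gamma> * ((u - p) \<bullet> (v - q))"
      by (metis inner_scaleR_right power2_norm_eq_inner)
    also have "\<dots> \<le> 0" using maximal_monotone_imp_monotone[OF max v that(1)] \<gamma> by simp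
    finally show ?thesis by simp
  qed
  then have "{p. \<exists>q\<in>T p. u + \<gamma> *\<^sub>R v = p + \<gamma> *\<^sub>R q} = {u}" using v by auto
  then show ?thesis by (simp add: resolvent_def inv)
qed

lemma resolvent_memb:
  fixes T :: "'a::euclidean_space \<Rightarrow> 'a set"
  assumes max: "maximal_monotone T" and \<gamma>: "0 < \<gamma>"
  shows "(1 / \<gamma>) *\<^sub>R (x - resolvent \<gamma> T x) \<in> T (resolvent \<gamma> T x)"
proof -
  obtain u v where uv: "v \<in> T u" "u + \<gamma> *\<^sub>R v = x" using Minty_surjective[OF assms] by blast
  then have "resolvent \<gamma> T x = u" using resolvent_eqI[OF assms uv(1)] by simp
  moreover have "(1 / \<gamma>) *\<^sub>R (x - u) = v" using uv(2) \<gamma> by auto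
  ultimately show ?thesis using uv by simp
qed

lemma resolvent_firmly_nonexpansive:
  fixes T :: "'a::euclidean_space \<Rightarrow> 'a set"
  assumes max: "maximal_monotone T" and \<gamma>: "0 < \<gamma>"
  defines "J \<equiv> resolvent \<gamma> T"
  shows "0 \<le> (J p - J q) \<bullet> ((p - q) - (J p - J q))"
proof -
  have "0 \<le> (J p - J q) \<bullet> ((1 / \<gamma>) *\<^sub>R (p - J p) - (1 / \<gamma>) *\<^sub>R (q - J q))"
    unfolding J_def by (intro maximal_monotone_imp_monotone[OF max] resolvent_memb assms)
  also have "\<dots> = (1 / \<gamma>) * ((J p - J q) \<bullet> ((p - q) - (J p - J q)))"
    by (simp add: inner_simps algebra_simps)
  finally show ?thesis using \<gamma> by (simp add: zero_le_divide_iff)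
qed

lemma resolvent_nonexpansive:
  fixes T :: "'a::euclidean_space \<Rightarrow> 'a set"
  assumes "maximal_monotone T" and "0 < \<gamma>"
  shows "norm (resolvent \<gamma> T p - resolvent \<gamma> T q) \<le> norm (p - q)"
proof -
  define d where "d = resolvent \<gamma> T p - resolvent \<gamma> T q"
  have "norm d * norm d \<le> d \<bullet> (p - q)"
    using resolvent_firmly_nonexpansive[OF assms, of p q]
    by (simp add: d_def[symmetric] inner_diff_right power2_norm_eq_inner power2_eq_square[symmetric])
  also have "\<dots> \<le> norm d * norm (p - q)" by (rule norm_cauchy_schwarz)
  finally show ?thesis unfolding d_def[symmetric] by (cases "d = 0") auto
qed

section \<open>Krasnoselskii-Mann iteration\<close>

lemma decseq_tendsto_zero_if_weighted_sum_bounded: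
  fixes c r V :: "nat \<Rightarrow> real"
  assumes c: "\<And>k. 0 \<le> c k" and r: "\<And>k. 0 \<le> r k" and V: "\<And>k. 0 \<le> V k"
    and dec: "\<And>k. r (Suc k) \<le> r k"
    and step: "\<And>k. V (Suc k) \<le> V k - c k * r k"
    and div: "filterlim (\<lambda>n. \<Sum>k<n. c k) at_top sequentially"
  shows "r \<longlonglongrightarrow> 0"
proof -
  have "decseq r" using dec by (rule decseq_SucI)
  then obtain l where l: "r \<longlonglongrightarrow> l" "\<And>k. l \<le> r k"
    using decseq_convergent[of r 0] r by blast
  have "0 \<le> l" using l(1) r by (intro LIMSEQ_le_const) auto
  have bound: "(\<Sum>k<n. c k) * l \<le> V 0" for n
  proof -
    have "(\<Sum>k<n. c k * r k) \<le> V 0 - V n"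
    proof (induction n)
      case (Suc n)
      then show ?case using step[of n] by simp
    qed simp
    moreover have "(\<Sum>k<n. c k) * l \<le> (\<Sum>k<n. c k * r k)"
      using c l(2) by (auto simp: sum_distrib_right intro!: sum_mono mult_left_mono)
    ultimately show ?thesis using V[of n] by linarith
  qed
  have "\<not> 0 < l"
  proof
    assume "0 < l"
    have "\<forall>\<^sub>F n in sequentially. V 0 / l + 1 \<le> (\<Sum>k<n. c k)"
      using div by (simp add: filterlim_at_top)
    then obtain n where "V 0 / l + 1 \<le> (\<Sum>k<n. c k)" by (auto simp: eventually_sequentially)
    then have "(V 0 / l + 1) * l \<le> V 0" using bound[of n] \<open>0 < l\<close>
      by (meson less_imp_le mult_right_mono order_trans)
    with \<open>0 < l\<close> show False by (simp add: distrib_right)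
  qed
  with \<open>0 \<le> l\<close> l(1) show ?thesis by simp
qed

text \<open>For \<open>L > 1\<close>, a map \<open>T\<close> is averaged with parameter \<open>1/L\<close> iff \<open>I - T\<close> is \<open>L/2\<close>-cocoercive; the cocoercivity is the form used here. The admissible relaxation parameters are then
  those in \<open>[0, L]\<close>.\<close>

locale averaged_map =
  fixes T :: "'a::euclidean_space \<Rightarrow> 'a" and L :: real
  assumes L_pos: "0 < L"
    and averaged: "L * (norm ((p - T p) - (q - T q)))\<^sup>2 \<le> 2 * ((p - q) \<bullet> ((p - T p) - (q - T q)))"
begin

lemma continuous_residual: "continuous_on UNIV (\<lambda>p. p - T p)"
proof -
  have "dist (p - T p) (q - T q) \<le> (2 / L) * dist p q" for p q
  proof -
    define d where "d = (p - T p) - (q - T q)"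
    have "L * (norm d * norm d) \<le> 2 * ((p - q) \<bullet> d)"
      using averaged[of p q] by (simp add: d_def power2_eq_square)
    also have "\<dots> \<le> 2 * (norm (p - q) * norm d)" using norm_cauchy_schwarz by simp
    finally have "norm d * (L * norm d) \<le> norm d * (2 * norm (p - q))" by (simp add: algebra_simps)
    then have "L * norm d \<le> 2 * norm (p - q)" by (cases "d = 0") auto
    then show ?thesis using L_pos by (simp add: d_def dist_norm field_simps)
  qed
  then have "(2 / L)-lipschitz_on UNIV (\<lambda>p. p - T p)" using L_pos by (intro lipschitz_onI) auto
  then show ?thesis by (rule lipschitz_on_continuous_on)
qed

lemma closed_Fix: "closed (Fix T)"
proof -
  have "Fix T = {p. p - T p = 0}" by (auto simp: Fix_def)
  then show ?thesis using continuous_closed_preimage_constant[OF continuous_residual closed_UNIV, of 0] by simp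
qed

lemma relaxed_step:
  assumes "p \<in> Fix T" and "0 \<le> l"
  shows "(norm (q + l *\<^sub>R (T q - q) - p))\<^sup>2 \<le> (norm (q - p))\<^sup>2 - l * (L - l) * (norm (T q - q))\<^sup>2"
proof -
  define d where "d = q - T q"
  have "L * (norm d)\<^sup>2 \<le> 2 * ((q - p) \<bullet> d)"
    using averaged[of q p] assms(1) by (simp add: d_def Fix_def)
  then have "l * (L * (norm d)\<^sup>2) \<le> l * (2 * ((q - p) \<bullet> d))" using assms(2) by (rule mult_left_mono)
  moreover have "(norm (q - p - l *\<^sub>R d))\<^sup>2 = (norm (q - p))\<^sup>2 - l * (2 * ((q - p) \<bullet> d)) + l * l * (norm d)\<^sup>2"
    by (simp add: norm_diff_scaleR_square power2_eq_square[of l])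
  moreover have "l * (L - l) * (norm d)\<^sup>2 = l * (L * (norm d)\<^sup>2) - l * l * (norm d)\<^sup>2"
    by (simp add: algebra_simps)
  ultimately have "(norm (q - p - l *\<^sub>R d))\<^sup>2 \<le> (norm (q - p))\<^sup>2 - l * (L - l) * (norm d)\<^sup>2"
    by linarith
  moreover have "q + l *\<^sub>R (T q - q) - p = q - p - l *\<^sub>R d" by (simp add: d_def scaleR_diff_right)
  moreover have "norm (T q - q) = norm d" by (simp add: d_def norm_minus_commute)
  ultimately show ?thesis by (simp only:)
qed

lemma residual_decreasing:
  assumes l: "0 \<le> l" "l \<le> L" and p: "p = q + l *\<^sub>R (T q - q)"
  shows "(norm (T p - p))\<^sup>2 \<le> (norm (T q - q))\<^sup>2"
proof (cases "l = 0")
  case False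
  define e where "e = q - T q"
  define h where "h = (p - T p) - e"
  have "L * (norm h)\<^sup>2 \<le> 2 * ((p - q) \<bullet> h)" using averaged[of p q] by (simp add: h_def e_def)
  also have "p - q = - l *\<^sub>R e" by (simp add: p e_def algebra_simps)
  finally have "l * (2 * (e \<bullet> h) + (norm h)\<^sup>2) \<le> (l - L) * (norm h)\<^sup>2" by (simp add: algebra_simps)
  also have "\<dots> \<le> 0" using l by (simp add: mult_nonpos_nonneg)
  finally have "2 * (e \<bullet> h) + (norm h)\<^sup>2 \<le> 0" using l False by (simp add: mult_le_0_iff)
  moreover have "(norm (e + h))\<^sup>2 = (norm e)\<^sup>2 + 2 * (e \<bullet> h) + (norm h)\<^sup>2"
    using norm_diff_scaleR_square[of e "- 1" h] by simp
  moreover have "norm (T p - p) = norm (e + h)" "norm (T q - q) = norm e"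
    by (simp_all add: h_def e_def norm_minus_commute)
  ultimately show ?thesis by simp
qed (simp add: p)

text \<open>Fejer monotonicity bounds the iterates; a cluster point is a fixed point because the residuals
  tend to zero, and the distance of the iterates to it is decreasing, so it is the limit.\<close>

theorem Krasnoselskii_Mann:
  assumes ne: "Fix T \<noteq> {}"
    and lam: "\<And>k. lam k \<in> {0..L}"
    and div: "filterlim (\<lambda>n. \<Sum>k<n. lam k * (L - lam k)) at_top sequentially"
    and x: "\<And>k. x (Suc k) = x k + lam k *\<^sub>R (T (x k) - x k)"
  shows "\<exists>xs\<in>Fix T. x \<longlonglongrightarrow> xs"
proof -
  have lam0: "0 \<le> lam k" and lamL: "lam k \<le> L" for k using lam[of k] by auto
  have step: "(norm (x (Suc k) - p))\<^sup>2
      \<le> (norm (x k - p))\<^sup>2 - lam k * (L - lam k) * (norm (T (x k) - x k))\<^sup>2" if "p \<in> Fix T" for p k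
    unfolding x by (rule relaxed_step[OF that lam0])
  have w: "0 \<le> lam k * (L - lam k)" for k using lam0 lamL by simp
  have fejer: "decseq (\<lambda>k. norm (x k - p))" if "p \<in> Fix T" for p
  proof (rule decseq_SucI)
    fix k
    have "(norm (x (Suc k) - p))\<^sup>2 \<le> (norm (x k - p))\<^sup>2"
      using step[OF that, of k] w[of k] by (smt (verit) mult_nonneg_nonneg zero_le_power2)
    then show "norm (x (Suc k) - p) \<le> norm (x k - p)" by (rule power2_le_imp_le) simp
  qed
  obtain p where p: "p \<in> Fix T" using ne by blast
  have "(\<lambda>k. (norm (T (x k) - x k))\<^sup>2) \<longlonglongrightarrow> 0"
    by (rule decseq_tendsto_zero_if_weighted_sum_bounded
        [where c = "\<lambda>k. lam k * (L - lam k)" and V = "\<lambda>k. (norm (x k - p))\<^sup>2"])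
      (use w step[OF p] div residual_decreasing[OF lam0 lamL x] in auto)
  then have "(\<lambda>k. sqrt ((norm (T (x k) - x k))\<^sup>2)) \<longlonglongrightarrow> sqrt 0" by (rule tendsto_real_sqrt)
  then have res0: "(\<lambda>k. x k - T (x k)) \<longlonglongrightarrow> 0"
    by (subst tendsto_norm_zero_iff[symmetric]) (simp add: norm_minus_commute)
  have "x k \<in> cball p (norm (x 0 - p))" for k
    using decseqD[OF fejer[OF p], of 0 k] by (simp add: dist_norm norm_minus_commute)
  then obtain xs r where r: "strict_mono (r :: nat \<Rightarrow> nat)" "(x \<circ> r) \<longlonglongrightarrow> xs"
    using compact_cball[of p "norm (x 0 - p)"] unfolding compact_def by meson
  have "((\<lambda>k. x (r k) - T (x (r k)))) \<longlonglongrightarrow> xs - T xs"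
    using continuous_on_tendsto_compose[OF continuous_residual r(2)] by (simp add: o_def)
  moreover have "((\<lambda>k. x (r k) - T (x (r k)))) \<longlonglongrightarrow> 0"
    using LIMSEQ_subseq_LIMSEQ[OF res0 r(1)] by (simp add: o_def)
  ultimately have xs: "xs \<in> Fix T" using LIMSEQ_unique by (fastforce simp: Fix_def)
  obtain l where l: "(\<lambda>k. norm (x k - xs)) \<longlonglongrightarrow> l"
    using decseq_convergent[OF fejer[OF xs], of 0] by auto
  have "(\<lambda>k. norm (x (r k) - xs)) \<longlonglongrightarrow> 0"
    using tendsto_norm_zero[OF LIM_zero[OF r(2)]] by (simp add: o_def)
  then have "l = 0" using LIMSEQ_subseq_LIMSEQ[OF l r(1)] LIMSEQ_unique by (fastforce simp: o_def)
  with l have "x \<longlonglongrightarrow> xs" by (simp add: LIM_zero_iff tendsto_norm_zero_iff)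
  with xs show ?thesis by blast
qed

text \<open>An error bound at \<open>q\<close> turns the Fejer inequality, taken at the projection of \<open>q\<close> onto the fixed
  point set, into a contraction of the distance.\<close>

lemma relaxed_step_dist:
  assumes ne: "Fix T \<noteq> {}" and l: "0 \<le> l" "l \<le> L" and "0 < K"
    and err: "infdist q (Fix T) \<le> K * norm (T q - q)"
  shows "(infdist (q + l *\<^sub>R (T q - q)) (Fix T))\<^sup>2 \<le> (1 - l * (L - l) / K\<^sup>2) * (infdist q (Fix T))\<^sup>2"
proof -
  obtain p where p: "p \<in> Fix T" "infdist q (Fix T) = dist q p"
    using infdist_attains_inf[OF closed_Fix ne] by blast
  have "infdist (q + l *\<^sub>R (T q - q)) (Fix T) \<le> norm (q + l *\<^sub>R (T q - q) - p)"
    using infdist_le[OF p(1)] by (simp add: dist_norm)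
  then have "(infdist (q + l *\<^sub>R (T q - q)) (Fix T))\<^sup>2 \<le> (norm (q + l *\<^sub>R (T q - q) - p))\<^sup>2"
    using infdist_nonneg by (intro power_mono) auto
  also have "\<dots> \<le> (infdist q (Fix T))\<^sup>2 - l * (L - l) * (norm (T q - q))\<^sup>2"
    using relaxed_step[OF p(1) l(1)] p(2) by (simp add: dist_norm)
  also have "\<dots> \<le> (infdist q (Fix T))\<^sup>2 - l * (L - l) * ((infdist q (Fix T))\<^sup>2 / K\<^sup>2)"
  proof -
    have "(infdist q (Fix T))\<^sup>2 \<le> (K * norm (T q - q))\<^sup>2" using err infdist_nonneg by (intro power_mono) auto
    then have "(infdist q (Fix T))\<^sup>2 / K\<^sup>2 \<le> (norm (T q - q))\<^sup>2"
      using \<open>0 < K\<close> by (simp add: power_mult_distrib field_simps)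
    then have "l * (L - l) * ((infdist q (Fix T))\<^sup>2 / K\<^sup>2) \<le> l * (L - l) * (norm (T q - q))\<^sup>2"
      using l by (intro mult_left_mono) auto
    then show ?thesis by linarith
  qed
  also have "\<dots> = (1 - l * (L - l) / K\<^sup>2) * (infdist q (Fix T))\<^sup>2" by (simp add: algebra_simps)
  finally show ?thesis .
qed

end


section \<open>Distances to sets and metric subregularity\<close>

lemma set_dist_eq_infdist:
  "S \<noteq> {} \<Longrightarrow> set_dist p S = ereal (infdist p S)"
proof -
  assume ne: "S \<noteq> {}"
  have "ereal (INF s\<in>S. norm (p - s)) = (INF s\<in>S. ereal (norm (p - s)))"
    using ne by (subst ereal_Inf') (auto simp: image_image intro!: bdd_belowI2[where m = 0])
  then show ?thesis using ne by (simp add: set_dist_def infdist_def dist_norm)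
qed

text \<open>The slack \<open>\<epsilon>\<close> avoids having to show that the distance to the set of zeros is attained.\<close>

lemma subregular_zero_near:
  fixes G :: "'a::real_normed_vector \<Rightarrow> 'a set"
  assumes sub: "\<forall>p\<in>U. set_dist p (op_inverse G 0) \<le> ereal \<kappa> * set_dist 0 (G p)" and \<kappa>: "0 \<le> \<kappa>"
    and ne: "op_inverse G 0 \<noteq> {}" and p: "p \<in> U" and w: "w \<in> G p" "norm w \<le> m"
    and \<epsilon>: "0 < \<epsilon>"
  shows "\<exists>q\<in>op_inverse G 0. norm (p - q) < \<kappa> * m + \<epsilon>"
proof -
  have "set_dist 0 (G p) \<le> ereal m"
    unfolding set_dist_def by (rule INF_lower2[OF w(1)]) (use w(2) in simp)
  then have "ereal \<kappa> * set_dist 0 (G p) \<le> ereal (\<kappa> * m)"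
    using ereal_mult_left_mono[of "set_dist 0 (G p)" "ereal m" "ereal \<kappa>"] \<kappa> by simp
  then have "set_dist p (op_inverse G 0) \<le> ereal (\<kappa> * m)"
    using sub p order_trans by blast
  also have "\<dots> < ereal (\<kappa> * m + \<epsilon>)" using \<epsilon> by simp
  finally show ?thesis by (auto simp: set_dist_def INF_less_iff)
qed

section \<open>The three-operator splitting map\<close>

text \<open>The data of the splitting method, without the iteration itself.\<close>

locale davis_splitting =
  fixes A B :: "'a::euclidean_space \<Rightarrow> 'a set" and C :: "'a \<Rightarrow> 'a" and \<theta> \<gamma> :: real
  assumes max_A: "maximal_monotone A" and max_B: "maximal_monotone B"
    and \<theta>_pos: "0 < \<theta>" and coco: "cocoercive \<theta> C"
    and \<gamma>_pos: "0 < \<gamma>" and \<gamma>_less: "\<gamma> < 2 * \<theta>"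
begin

text \<open>The operator whose zeros are sought.\<close>

definition F :: "'a \<Rightarrow> 'a set" where "F = op_add (op_add A B) (op_single C)"

text \<open>The iteration map of the method.\<close>

definition T :: "'a \<Rightarrow> 'a" where "T = davis_map \<gamma> A B C"

text \<open>The resolvent of \<open>B\<close>, which sends \<open>x\<^sub>k\<close> to \<open>z\<^sub>k\<close>.\<close>

definition JB :: "'a \<Rightarrow> 'a" where "JB = resolvent \<gamma> B"

text \<open>Following the algorithm, \<open>JA p\<close> is not the resolvent of \<open>A\<close> at \<open>p\<close> but at the point
  \<open>2z - p - \<gamma>Cz\<close> with \<open>z = JB p\<close>; thus \<open>JB\<close> and \<open>JA\<close> send \<open>x\<^sub>k\<close> to \<open>z\<^sub>k\<close> and \<open>y\<^sub>k\<close>.\<close>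

definition JA :: "'a \<Rightarrow> 'a" where
  "JA p = resolvent \<gamma> A (2 *\<^sub>R JB p - p - \<gamma> *\<^sub>R C (JB p))"

lemma mem_F: "w \<in> F p \<longleftrightarrow> (\<exists>a\<in>A p. \<exists>b\<in>B p. w = a + b + C p)"
  by (force simp: F_def op_add_def op_single_def set_plus_def)

lemma T_eq: "T p = p - JB p + JA p"
  by (simp add: T_def davis_map_def JB_def JA_def)

lemma residual_eq: "p - T p = JB p - JA p"
  by (simp add: T_eq)

lemma JB_memb: "(1 / \<gamma>) *\<^sub>R (p - JB p) \<in> B (JB p)"
  unfolding JB_def by (rule resolvent_memb[OF max_B \<gamma>_pos])

lemma JA_memb: "(1 / \<gamma>) *\<^sub>R (2 *\<^sub>R JB p - p - \<gamma> *\<^sub>R C (JB p) - JA p) \<in> A (JA p)"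
  unfolding JA_def by (rule resolvent_memb[OF max_A \<gamma>_pos])

lemma coco': "\<theta> * (norm (C p - C q))\<^sup>2 \<le> (p - q) \<bullet> (C p - C q)"
  using coco by (simp add: cocoercive_def)

lemma C_lipschitz: "norm (C p - C q) \<le> norm (p - q) / \<theta>"
proof -
  have "norm (C p - C q) * (\<theta> * norm (C p - C q)) \<le> norm (C p - C q) * norm (p - q)"
    using coco'[of p q] norm_cauchy_schwarz[of "p - q" "C p - C q"]
    by (simp add: power2_eq_square algebra_simps)
  then have "\<theta> * norm (C p - C q) \<le> norm (p - q)" by (cases "C p = C q") auto
  then show ?thesis using \<theta>_pos by (simp add: field_simps)
qed

text \<open>With \<open>\<Delta>\<close> denoting differences at \<open>p\<close> and \<open>q\<close>, monotonicity of \<open>A\<close> and \<open>B\<close> gives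
  \<open>\<langle>\<Delta>p, d\<rangle> \<ge> |d|\<^sup>2 + \<gamma>\<langle>\<Delta>y, \<Delta>c\<rangle>\<close> for \<open>d = \<Delta>z - \<Delta>y\<close>, and cocoercivity of \<open>C\<close> bounds the last
  term from below by \<open>- \<gamma>/(4\<theta>) |d|\<^sup>2\<close>.\<close>

lemma residual_cocoercive:
  "(4 * \<theta> - \<gamma>) / (2 * \<theta>) * (norm ((p - T p) - (q - T q)))\<^sup>2 \<le> 2 * ((p - q) \<bullet> ((p - T p) - (q - T q)))"
proof -
  define X where "X = p - q"
  define Z where "Z = JB p - JB q"
  define Y where "Y = JA p - JA q"
  define c where "c = C (JB p) - C (JB q)"
  define d where "d = Z - Y"
  have B: "0 \<le> Z \<bullet> (X - Z)"
    unfolding Z_def X_def JB_def by (rule resolvent_firmly_nonexpansive[OF max_B \<gamma>_pos])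
  have A: "0 \<le> Y \<bullet> (2 *\<^sub>R Z - X - \<gamma> *\<^sub>R c - Y)"
  proof -
    have "2 *\<^sub>R Z - X - \<gamma> *\<^sub>R c - Y = (2 *\<^sub>R JB p - p - \<gamma> *\<^sub>R C (JB p))
        - (2 *\<^sub>R JB q - q - \<gamma> *\<^sub>R C (JB q)) - (JA p - JA q)"
      by (simp add: Y_def Z_def X_def c_def scaleR_diff_right)
    then show ?thesis
      unfolding Y_def JA_def by (simp only: resolvent_firmly_nonexpansive[OF max_A \<gamma>_pos])
  qed
  have C: "\<gamma> * (\<theta> * (norm c)\<^sup>2) \<le> \<gamma> * (Z \<bullet> c)"
    using coco'[of "JB p" "JB q"] \<gamma>_pos by (simp add: Z_def c_def)
  \<comment> \<open>Since \<open>\<langle>\<Delta>y, \<Delta>c\<rangle> = \<langle>\<Delta>z, \<Delta>c\<rangle> - \<langle>d, \<Delta>c\<rangle>\<close>, completing the square in \<open>\<Delta>c\<close> gives the bound.\<close>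
  have square: "0 \<le> \<gamma> * \<theta> * (norm c)\<^sup>2 - \<gamma> * (d \<bullet> c) + \<gamma> / (4 * \<theta>) * (norm d)\<^sup>2"
  proof -
    have "\<gamma> * \<theta> * (norm c)\<^sup>2 - \<gamma> * (d \<bullet> c) + \<gamma> / (4 * \<theta>) * (norm d)\<^sup>2
        = \<gamma> * \<theta> * (norm (c - (1 / (2 * \<theta>)) *\<^sub>R d))\<^sup>2"
      unfolding norm_diff_scaleR_square inner_commute[of c d]
      using \<theta>_pos by (simp add: field_simps power2_eq_square)
    then show ?thesis using \<theta>_pos \<gamma>_pos by simp
  qed
  have "Z \<bullet> (X - Z) + Y \<bullet> (2 *\<^sub>R Z - X - \<gamma> *\<^sub>R c - Y)
      = X \<bullet> d - (norm d)\<^sup>2 - \<gamma> * (Z \<bullet> c) + \<gamma> * (d \<bullet> c)"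
    by (simp add: d_def power2_norm_eq_inner inner_simps inner_commute algebra_simps)
  with A B C square have "(norm d)\<^sup>2 - \<gamma> / (4 * \<theta>) * (norm d)\<^sup>2 \<le> X \<bullet> d" by (simp add: mult.assoc)
  moreover have "(4 * \<theta> - \<gamma>) / (2 * \<theta>) * (norm d)\<^sup>2 = 2 * ((norm d)\<^sup>2 - \<gamma> / (4 * \<theta>) * (norm d)\<^sup>2)"
    using \<theta>_pos by (simp add: field_simps)
  ultimately have "(4 * \<theta> - \<gamma>) / (2 * \<theta>) * (norm d)\<^sup>2 \<le> 2 * (X \<bullet> d)" by simp
  moreover have "(p - T p) - (q - T q) = d" by (simp add: residual_eq d_def Z_def Y_def)
  ultimately show ?thesis by (simp add: X_def)
qed

sublocale averaged_map T "(4 * \<theta> - \<gamma>) / (2 * \<theta>)"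
proof
  show "0 < (4 * \<theta> - \<gamma>) / (2 * \<theta>)" using \<theta>_pos \<gamma>_less by simp
qed (rule residual_cocoercive)

text \<open>Zeros of \<open>F\<close> and fixed points of \<open>T\<close> correspond: \<open>p\<close> goes to \<open>p + \<gamma>b\<close>, and \<open>JB\<close> leads back.\<close>

lemma mem_FixI:
  assumes "a \<in> A p" "b \<in> B p" "a + b + C p = 0"
  shows "p + \<gamma> *\<^sub>R b \<in> Fix T"
proof -
  have JB: "JB (p + \<gamma> *\<^sub>R b) = p"
    unfolding JB_def by (rule resolvent_eqI[OF max_B \<gamma>_pos assms(2)])
  have "b + C p = - a" using assms(3) by (metis add.assoc add_eq_0_iff)
  then have "\<gamma> *\<^sub>R b + \<gamma> *\<^sub>R C p = - (\<gamma> *\<^sub>R a)" by (simp flip: scaleR_add_right)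
  then have "2 *\<^sub>R p - (p + \<gamma> *\<^sub>R b) - \<gamma> *\<^sub>R C p = p + \<gamma> *\<^sub>R a"
    by (simp add: scaleR_2 algebra_simps)
  then have "JA (p + \<gamma> *\<^sub>R b) = p"
    unfolding JA_def JB using resolvent_eqI[OF max_A \<gamma>_pos assms(1)] by simp
  then show ?thesis by (simp add: Fix_def T_eq JB)
qed

lemma Fix_nonempty: "op_inverse F 0 \<noteq> {} \<Longrightarrow> Fix T \<noteq> {}"
  using mem_FixI by (force simp: op_inverse_def mem_F)

lemma JB_Fix_is_zero:
  assumes "p \<in> Fix T"
  shows "JB p \<in> op_inverse F 0"
proof -
  have eq: "JA p = JB p" using assms by (simp add: Fix_def T_eq)
  have "(1 / \<gamma>) *\<^sub>R (2 *\<^sub>R JB p - p - \<gamma> *\<^sub>R C (JB p) - JB p) + (1 / \<gamma>) *\<^sub>R (p - JB p) + C (JB p) = 0"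
    using \<gamma>_pos by (simp add: scaleR_2 algebra_simps)
  with JA_memb[of p] JB_memb[of p] show ?thesis
    unfolding op_inverse_def mem_Collect_eq mem_F eq by metis
qed

lemma tendsto_JB: "x \<longlonglongrightarrow> p \<Longrightarrow> (\<lambda>k. JB (x k)) \<longlonglongrightarrow> JB p"
proof -
  assume x: "x \<longlonglongrightarrow> p"
  have "1-lipschitz_on UNIV JB"
    by (rule lipschitz_onI) (simp_all add: JB_def dist_norm resolvent_nonexpansive[OF max_B \<gamma>_pos])
  then have "continuous_on UNIV JB" by (rule lipschitz_on_continuous_on)
  from continuous_on_tendsto_compose[OF this x] show ?thesis by simp
qed

lemma tendsto_JA:
  assumes x: "x \<longlonglongrightarrow> p" and p: "p \<in> Fix T"
  shows "(\<lambda>k. JA (x k)) \<longlonglongrightarrow> JB p"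
proof -
  have "(\<lambda>k. x k - T (x k)) \<longlonglongrightarrow> p - T p"
    using continuous_on_tendsto_compose[OF continuous_residual x] by simp
  then have "(\<lambda>k. JB (x k) - (x k - T (x k))) \<longlonglongrightarrow> JB p - (p - T p)"
    by (rule tendsto_diff[OF tendsto_JB[OF x]])
  moreover have "p - T p = 0" using p by (simp add: Fix_def)
  ultimately show ?thesis by (simp add: residual_eq)
qed

lemma linear_rate:
  assumes ne: "Fix T \<noteq> {}" and lam: "0 \<le> l" "l \<le> (4 * \<theta> - \<gamma>) / (2 * \<theta>)" and K: "0 < K"
    and err: "infdist q (Fix T) \<le> K * norm (T q - q)"
  shows "(set_dist (q + l *\<^sub>R (T q - q)) (Fix T))\<^sup>2
    \<le> ereal (1 - l * (4 * \<theta> - \<gamma> - 2 * \<theta> * l) / (2 * \<theta> * K\<^sup>2)) * (set_dist q (Fix T))\<^sup>2"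
proof -
  have "l * ((4 * \<theta> - \<gamma>) / (2 * \<theta>) - l) / K\<^sup>2 = l * (4 * \<theta> - \<gamma> - 2 * \<theta> * l) / (2 * \<theta> * K\<^sup>2)"
    using \<theta>_pos K by (simp add: field_simps)
  then show ?thesis
    using relaxed_step_dist[OF ne lam K err] by (simp add: set_dist_eq_infdist[OF ne] power2_eq_square)
qed

text \<open>Error bound for Lipschitz \<open>A\<close>. Here \<open>q = 2z - y - \<gamma>Ay - \<gamma>Cz\<close>, while a zero \<open>zb\<close> of \<open>F\<close> gives the
  fixed point \<open>zb - \<gamma>A zb - \<gamma>C zb\<close>; the two are compared term by term. The set
  \<open>U\<close> is where the inequality of metric subregularity holds; it is used only at \<open>z\<close>.\<close>

lemma error_bound_A:
  assumes A: "\<And>p. A p = {f p}" and lip: "(1 / \<beta>)-lipschitz_on UNIV f" and \<beta>: "0 < \<beta>"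
    and sub: "\<forall>p\<in>U. set_dist p (op_inverse F 0) \<le> ereal \<kappa> * set_dist 0 (F p)" and \<kappa>: "0 < \<kappa>"
    and ne: "op_inverse F 0 \<noteq> {}" and q: "JB q \<in> U"
  shows "infdist q (Fix T)
    \<le> ((2 + \<gamma> / \<theta>) + (\<gamma> / \<theta> + sqrt (1 + \<gamma>\<^sup>2 / \<beta>\<^sup>2)) * (1 + \<kappa> * (1 / \<gamma> + 1 / \<beta>))) * norm (T q - q)"
proof -
  define s where "s = sqrt (1 + \<gamma>\<^sup>2 / \<beta>\<^sup>2)"
  define z where "z = JB q"
  define y where "y = JA q"
  define e where "e = norm (z - y)"
  have e: "norm (T q - q) = e" by (simp add: e_def z_def y_def T_eq norm_minus_commute)
  have f_lip: "norm (f p - f p') \<le> norm (p - p') / \<beta>" for p p'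
    using lipschitz_onD[OF lip, of p p'] by (simp add: dist_norm)
  have f_mono: "0 \<le> (p - p') \<bullet> (f p - f p')" for p p'
    using maximal_monotone_imp_monotone[OF max_A, of "f p" p "f p'" p'] by (simp add: A)
  have fy: "\<gamma> *\<^sub>R f y = 2 *\<^sub>R z - q - \<gamma> *\<^sub>R C z - y"
  proof -
    have "(1 / \<gamma>) *\<^sub>R (2 *\<^sub>R z - q - \<gamma> *\<^sub>R C z - y) = f y"
      using JA_memb[of q] unfolding z_def y_def by (simp only: A singleton_iff)
    then show ?thesis using \<gamma>_pos by (simp flip: \<open>_ = f y\<close>)
  qed
  \<comment> \<open>Monotonicity lets the cross term be dropped, whence \<open>s\<close> instead of \<open>1 + \<gamma>/\<beta>\<close>.\<close>
  have reflected: "norm ((p - p') - \<gamma> *\<^sub>R (f p - f p')) \<le> s * norm (p - p')" for p p'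
  proof -
    have "(norm ((p - p') - \<gamma> *\<^sub>R (f p - f p')))\<^sup>2
        = (norm (p - p'))\<^sup>2 - 2 * \<gamma> * ((p - p') \<bullet> (f p - f p')) + \<gamma>\<^sup>2 * (norm (f p - f p'))\<^sup>2"
      by (rule norm_diff_scaleR_square)
    also have "\<dots> \<le> (norm (p - p'))\<^sup>2 + \<gamma>\<^sup>2 * (norm (p - p') / \<beta>)\<^sup>2"
    proof -
      have "0 \<le> 2 * \<gamma> * ((p - p') \<bullet> (f p - f p'))" using f_mono \<gamma>_pos by simp
      moreover have "\<gamma>\<^sup>2 * (norm (f p - f p'))\<^sup>2 \<le> \<gamma>\<^sup>2 * (norm (p - p') / \<beta>)\<^sup>2"
        using f_lip by (intro mult_left_mono power_mono) auto
      ultimately show ?thesis by linarith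
    qed
    also have "\<dots> = (s * norm (p - p'))\<^sup>2"
      using \<beta> by (simp add: s_def power_mult_distrib power_divide real_sqrt_pow2 algebra_simps add_nonneg_nonneg)
    finally show ?thesis by (rule power2_le_imp_le) (simp add: s_def add_nonneg_nonneg)
  qed
  define w where "w = f z + (1 / \<gamma>) *\<^sub>R (q - z) + C z"
  have w_mem: "w \<in> F z"
    using JB_memb[of q] by (auto simp: mem_F w_def A z_def)
  have "\<gamma> *\<^sub>R w = (z - y) + \<gamma> *\<^sub>R (f z - f y)"
    using \<gamma>_pos fy by (simp add: w_def algebra_simps scaleR_2)
  then have "(1 / \<gamma>) *\<^sub>R (\<gamma> *\<^sub>R w) = (1 / \<gamma>) *\<^sub>R ((z - y) + \<gamma> *\<^sub>R (f z - f y))"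
    by (rule arg_cong)
  then have "w = (1 / \<gamma>) *\<^sub>R (z - y) + (f z - f y)"
    using \<gamma>_pos by (simp only: scaleR_add_right scaleR_scaleR) simp
  then have "norm w \<le> norm ((1 / \<gamma>) *\<^sub>R (z - y)) + norm (f z - f y)"
    by (simp only: norm_triangle_ineq)
  also have "\<dots> \<le> (1 / \<gamma> + 1 / \<beta>) * e"
    using f_lip[of z y] \<gamma>_pos by (simp add: e_def distrib_right)
  finally have w_le: "norm w \<le> (1 / \<gamma> + 1 / \<beta>) * e" .
  define g where "g = \<gamma> / \<theta>"
  have g: "0 \<le> g" "0 \<le> s" using \<gamma>_pos \<theta>_pos by (simp_all add: g_def s_def add_nonneg_nonneg)
  have dist_le: "infdist q (Fix T) \<le> (2 + g) * e + (g + s) * (e + norm (z - zb))"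
    if zb: "zb \<in> op_inverse F 0" for zb
  proof -
    obtain b where b: "b \<in> B zb" "f zb + b + C zb = 0"
      using zb by (auto simp: op_inverse_def mem_F A)
    define xb where "xb = zb + \<gamma> *\<^sub>R b"
    have xb: "xb \<in> Fix T" unfolding xb_def by (rule mem_FixI[OF _ b]) (simp add: A)
    have "b = (f zb + b + C zb) - f zb - C zb" by simp
    also have "\<dots> = - f zb - C zb" by (simp only: b(2)) simp
    finally have b_eq: "b = - f zb - C zb" .
    have xb_eq: "xb = zb - \<gamma> *\<^sub>R f zb - \<gamma> *\<^sub>R C zb"
      unfolding xb_def by (subst b_eq) (simp add: scaleR_diff_right)
    have q_eq: "q = 2 *\<^sub>R z - y - \<gamma> *\<^sub>R f y - \<gamma> *\<^sub>R C z" using fy by (simp add: algebra_simps)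
    have "q - xb = 2 *\<^sub>R (z - y) + ((y - zb) - \<gamma> *\<^sub>R (f y - f zb)) - \<gamma> *\<^sub>R (C z - C zb)"
      by (subst q_eq, subst xb_eq) (simp add: algebra_simps scaleR_2)
    then have "norm (q - xb) \<le> norm (2 *\<^sub>R (z - y)) + norm ((y - zb) - \<gamma> *\<^sub>R (f y - f zb))
        + norm (\<gamma> *\<^sub>R (C z - C zb))"
      by (simp only:) (rule order_trans[OF norm_triangle_ineq4 add_right_mono[OF norm_triangle_ineq]])
    also have "\<dots> \<le> 2 * e + s * norm (y - zb) + g * norm (z - zb)"
    proof (intro add_mono reflected)
      show "norm (2 *\<^sub>R (z - y)) \<le> 2 * e" unfolding norm_scaleR e_def by simp
      have "norm (\<gamma> *\<^sub>R (C z - C zb)) = \<gamma> * norm (C z - C zb)" using \<gamma>_pos unfolding norm_scaleR by simp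
      also have "\<dots> \<le> \<gamma> * (norm (z - zb) / \<theta>)" using C_lipschitz \<gamma>_pos by (intro mult_left_mono) auto
      finally show "norm (\<gamma> *\<^sub>R (C z - C zb)) \<le> g * norm (z - zb)" by (simp add: g_def)
    qed
    also have "\<dots> \<le> 2 * e + s * (e + norm (z - zb)) + g * (e + (e + norm (z - zb)))"
    proof -
      have "norm (y - zb) \<le> e + norm (z - zb)"
        using norm_triangle_ineq[of "y - z" "z - zb"] by (simp add: e_def norm_minus_commute)
      then show ?thesis using g by (intro add_mono mult_left_mono) (auto simp: e_def)
    qed
    also have "\<dots> = (2 + g) * e + (g + s) * (e + norm (z - zb))" by (simp add: algebra_simps)
    finally show ?thesis using infdist_le[OF xb, of q] by (simp add: dist_norm)
  qed
  have gs: "0 < g + s"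
    using g by (simp add: s_def add_nonneg_pos add_pos_nonneg)
  have "infdist q (Fix T) \<le> (2 + g) * e + (g + s) * (e + \<kappa> * ((1 / \<gamma> + 1 / \<beta>) * e)) + \<epsilon>"
    if "0 < \<epsilon>" for \<epsilon>
  proof -
    have "0 < \<epsilon> / (g + s)" using that gs by simp
    then obtain zb where zb: "zb \<in> op_inverse F 0"
      "norm (z - zb) < \<kappa> * ((1 / \<gamma> + 1 / \<beta>) * e) + \<epsilon> / (g + s)"
      using subregular_zero_near[OF sub _ ne _ w_mem w_le] \<kappa> q by (auto simp: z_def)
    then have "(g + s) * (e + norm (z - zb))
        \<le> (g + s) * (e + (\<kappa> * ((1 / \<gamma> + 1 / \<beta>) * e) + \<epsilon> / (g + s)))"
      using gs by (intro mult_left_mono) auto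
    also have "\<dots> = (g + s) * (e + \<kappa> * ((1 / \<gamma> + 1 / \<beta>) * e)) + \<epsilon>"
      using gs by (simp add: distrib_left)
    finally show ?thesis using dist_le[OF zb(1)] by linarith
  qed
  then have "infdist q (Fix T) \<le> (2 + g) * e + (g + s) * (e + \<kappa> * ((1 / \<gamma> + 1 / \<beta>) * e))"
    by (rule field_le_epsilon)
  also have "\<dots> = ((2 + g) + (g + s) * (1 + \<kappa> * (1 / \<gamma> + 1 / \<beta>))) * e"
    by (simp add: distrib_right distrib_left mult.assoc)
  finally show ?thesis by (simp only: e g_def s_def)
qed

text \<open>Error bound for Lipschitz \<open>B\<close>. Here \<open>q = z + \<gamma>Bz\<close>, while a zero \<open>zb\<close> of \<open>F\<close> gives the fixed point
  \<open>zb + \<gamma>B zb\<close>. The element of \<open>F y\<close> involves \<open>(z - y)/\<gamma> - (Cz - Cy)\<close>, whose norm is at most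
  \<open>|z - y|/\<gamma>\<close> because \<open>\<gamma> \<le> 2\<theta>\<close>. Metric subregularity is used at \<open>y\<close>.\<close>

lemma error_bound_B:
  assumes B: "\<And>p. B p = {f p}" and lip: "(1 / \<beta>)-lipschitz_on UNIV f" and \<beta>: "0 < \<beta>"
    and sub: "\<forall>p\<in>U. set_dist p (op_inverse F 0) \<le> ereal \<kappa> * set_dist 0 (F p)" and \<kappa>: "0 < \<kappa>"
    and ne: "op_inverse F 0 \<noteq> {}" and q: "JA q \<in> U"
  shows "infdist q (Fix T) \<le> (1 + \<gamma> / \<beta>) * (1 + \<kappa> * (1 / \<beta> + 1 / \<gamma>)) * norm (T q - q)"
proof -
  define z where "z = JB q"
  define y where "y = JA q"
  define e where "e = norm (z - y)"
  have e: "norm (T q - q) = e" by (simp add: e_def z_def y_def T_eq norm_minus_commute)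
  have f_lip: "norm (f p - f p') \<le> norm (p - p') / \<beta>" for p p'
    using lipschitz_onD[OF lip, of p p'] by (simp add: dist_norm)
  have fz: "q = z + \<gamma> *\<^sub>R f z"
  proof -
    have "(1 / \<gamma>) *\<^sub>R (q - z) = f z"
      using JB_memb[of q] unfolding z_def by (simp only: B singleton_iff)
    then show ?thesis using \<gamma>_pos by (simp flip: \<open>_ = f z\<close>)
  qed
  define v where "v = C z - C y"
  have forward: "norm ((1 / \<gamma>) *\<^sub>R (z - y) - v) \<le> (1 / \<gamma>) * e"
  proof -
    have "(norm ((z - y) - \<gamma> *\<^sub>R v))\<^sup>2 = e\<^sup>2 - 2 * \<gamma> * ((z - y) \<bullet> v) + \<gamma> * \<gamma> * (norm v)\<^sup>2"
      by (simp add: e_def norm_diff_scaleR_square power2_eq_square[of \<gamma>])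
    also have "\<dots> \<le> e\<^sup>2"
    proof -
      have "\<gamma> * (\<gamma> * (norm v)\<^sup>2) \<le> \<gamma> * (2 * (\<theta> * (norm v)\<^sup>2))"
        using \<gamma>_pos \<gamma>_less mult_right_mono[of \<gamma> "2 * \<theta>" "(norm v)\<^sup>2"] by (intro mult_left_mono) auto
      also have "\<dots> \<le> \<gamma> * (2 * ((z - y) \<bullet> v))"
        using \<gamma>_pos coco'[of z y] by (simp add: v_def)
      finally show ?thesis by simp
    qed
    finally have "norm ((z - y) - \<gamma> *\<^sub>R v) \<le> e" by (rule power2_le_imp_le) (simp add: e_def)
    moreover have "(1 / \<gamma>) *\<^sub>R (z - y) - v = (1 / \<gamma>) *\<^sub>R ((z - y) - \<gamma> *\<^sub>R v)"
      using \<gamma>_pos by (simp add: scaleR_diff_right)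
    ultimately show ?thesis using \<gamma>_pos by (simp add: divide_right_mono)
  qed
  define a where "a = (1 / \<gamma>) *\<^sub>R (2 *\<^sub>R z - q - \<gamma> *\<^sub>R C z - y)"
  have w_mem: "a + f y + C y \<in> F y"
    using JA_memb[of q] by (auto simp: mem_F B a_def z_def y_def)
  have "a = (1 / \<gamma>) *\<^sub>R (z - y) - f z - C z"
    using \<gamma>_pos by (simp add: a_def fz algebra_simps scaleR_2)
  then have "a + f y + C y = ((1 / \<gamma>) *\<^sub>R (z - y) - v) - (f z - f y)"
    by (simp add: v_def algebra_simps)
  then have "norm (a + f y + C y) \<le> norm ((1 / \<gamma>) *\<^sub>R (z - y) - v) + norm (f z - f y)"
    by (simp only: norm_triangle_ineq4)
  also have "\<dots> \<le> (1 / \<beta> + 1 / \<gamma>) * e"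
    using forward f_lip[of z y] by (simp add: e_def distrib_right)
  finally have w_le: "norm (a + f y + C y) \<le> (1 / \<beta> + 1 / \<gamma>) * e" .
  have dist_le: "infdist q (Fix T) \<le> (1 + \<gamma> / \<beta>) * (e + norm (y - zb))"
    if zb: "zb \<in> op_inverse F 0" for zb
  proof -
    obtain a' where a': "a' \<in> A zb" "a' + f zb + C zb = 0"
      using zb by (auto simp: op_inverse_def mem_F B)
    define xb where "xb = zb + \<gamma> *\<^sub>R f zb"
    have xb: "xb \<in> Fix T" unfolding xb_def by (rule mem_FixI[OF a'(1) _ a'(2)]) (simp add: B)
    have "q - xb = (z - zb) + \<gamma> *\<^sub>R (f z - f zb)" by (simp add: xb_def fz algebra_simps)
    then have "norm (q - xb) \<le> norm (z - zb) + norm (\<gamma> *\<^sub>R (f z - f zb))"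
      by (simp only: norm_triangle_ineq)
    also have "\<dots> \<le> (1 + \<gamma> / \<beta>) * norm (z - zb)"
      using mult_left_mono[OF f_lip[of z zb], of \<gamma>] \<gamma>_pos by (simp add: distrib_right)
    also have "\<dots> \<le> (1 + \<gamma> / \<beta>) * (e + norm (y - zb))"
      using norm_triangle_ineq[of "z - y" "y - zb"] \<gamma>_pos \<beta>
      by (intro mult_left_mono) (auto simp: e_def)
    finally show ?thesis using infdist_le[OF xb, of q] by (simp add: dist_norm)
  qed
  have k: "0 < 1 + \<gamma> / \<beta>" using \<gamma>_pos \<beta> by (simp add: add_pos_pos)
  have "infdist q (Fix T) \<le> (1 + \<gamma> / \<beta>) * (e + \<kappa> * ((1 / \<beta> + 1 / \<gamma>) * e)) + \<epsilon>"
    if "0 < \<epsilon>" for \<epsilon>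
  proof -
    have "0 < \<epsilon> / (1 + \<gamma> / \<beta>)" using that k by simp
    then obtain zb where zb: "zb \<in> op_inverse F 0"
      "norm (y - zb) < \<kappa> * ((1 / \<beta> + 1 / \<gamma>) * e) + \<epsilon> / (1 + \<gamma> / \<beta>)"
      using subregular_zero_near[OF sub _ ne _ w_mem w_le] \<kappa> q by (auto simp: y_def)
    then have "(1 + \<gamma> / \<beta>) * (e + norm (y - zb))
        \<le> (1 + \<gamma> / \<beta>) * (e + (\<kappa> * ((1 / \<beta> + 1 / \<gamma>) * e) + \<epsilon> / (1 + \<gamma> / \<beta>)))"
      using k by (intro mult_left_mono) auto
    also have "\<dots> = (1 + \<gamma> / \<beta>) * (e + \<kappa> * ((1 / \<beta> + 1 / \<gamma>) * e)) + \<epsilon>"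
      using k by (simp only: distrib_left add.assoc[symmetric]) simp
    finally show ?thesis using dist_le[OF zb(1)] by linarith
  qed
  then have "infdist q (Fix T) \<le> (1 + \<gamma> / \<beta>) * (e + \<kappa> * ((1 / \<beta> + 1 / \<gamma>) * e))"
    by (rule field_le_epsilon)
  also have "\<dots> = (1 + \<gamma> / \<beta>) * (1 + \<kappa> * (1 / \<beta> + 1 / \<gamma>)) * e"
    by (simp only: distrib_right mult.assoc mult_1_left)
  finally show ?thesis by (simp only: e)
qed

end

section \<open>Convergence and linear rates of the splitting method\<close>

theorem theorem3p5:
  fixes A B F :: "'a::euclidean_space \<Rightarrow> 'a set"
    and C T :: "'a \<Rightarrow> 'a"
    and \<theta> \<gamma> :: real
    and lam :: "nat \<Rightarrow> real"
    and x y z :: "nat \<Rightarrow> 'a"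
  defines "F \<equiv> op_add (op_add A B) (op_single C)"
    and "T \<equiv> davis_map \<gamma> A B C"
  assumes "maximal_monotone A" and "maximal_monotone B"
    and "\<theta> > 0" and "cocoercive \<theta> C"
    and "op_inverse F 0 \<noteq> {}"
    and "0 < \<gamma>" and "\<gamma> < 2 * \<theta>"
    and "\<And>k. lam k \<in> {0 .. (4 * \<theta> - \<gamma>) / (2 * \<theta>)}"
    and "filterlim (\<lambda>n. \<Sum>k<n. lam k * ((4 * \<theta> - \<gamma>) / (2 * \<theta>) - lam k)) at_top sequentially"
    and "\<And>k. z k = resolvent \<gamma> B (x k)"
    and "\<And>k. y k = resolvent \<gamma> A (2 *\<^sub>R z k - x k - \<gamma> *\<^sub>R C (z k))"
    and "\<And>k. x (Suc k) = x k + lam k *\<^sub>R (y k - z k)"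
  shows "\<exists>zs xs.
    (zs \<in> op_inverse F 0 \<and> y \<longlonglongrightarrow> zs \<and> z \<longlonglongrightarrow> zs \<and>
     xs \<in> Fix T \<and> x \<longlonglongrightarrow> xs \<and>
     (\<forall>p \<in> Fix T. \<forall>k.
        (norm (x (Suc k) - p))\<^sup>2
          \<le> (norm (x k - p))\<^sup>2
             - lam k * ((4 * \<theta> - \<gamma>) / (2 * \<theta>) - lam k) * (norm (T (x k) - x k))\<^sup>2)) \<and>
    (\<forall>\<beta> \<kappa>. \<beta> > 0 \<and> single_valued_lipschitz (1 / \<beta>) A \<and>
        \<kappa> > 0 \<and> metrically_subregular F zs 0 \<kappa> \<longrightarrow>
      (\<exists>kbar. \<forall>k\<ge>kbar.
        (set_dist (x (Suc k)) (Fix T))\<^sup>2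
          \<le> ereal (1 - lam k * (4 * \<theta> - \<gamma> - 2 * \<theta> * lam k)
                / (2 * \<theta> * ((2 + \<gamma> / \<theta>)
                     + (\<gamma> / \<theta> + sqrt (1 + \<gamma>\<^sup>2 / \<beta>\<^sup>2)) * (1 + \<kappa> * (1 / \<gamma> + 1 / \<beta>)))\<^sup>2))
             * (set_dist (x k) (Fix T))\<^sup>2)) \<and>
    (\<forall>\<beta> \<kappa>. \<beta> > 0 \<and> single_valued_lipschitz (1 / \<beta>) B \<and>
        \<kappa> > 0 \<and> metrically_subregular F zs 0 \<kappa> \<longrightarrow>
      (\<exists>kbar. \<forall>k\<ge>kbar.
        (set_dist (x (Suc k)) (Fix T))\<^sup>2
          \<le> ereal (1 - lam k * (4 * \<theta> - \<gamma> - 2 * \<theta> * lam k)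
                / (2 * \<theta> * (1 + \<gamma> / \<beta>)\<^sup>2
                   * (1 + \<kappa> * (1 / \<beta>
                        + 1 / \<gamma> * sqrt (1 + max ((\<gamma>\<^sup>2 - 2 * \<gamma> * \<theta>) / \<theta>\<^sup>2) 0)))\<^sup>2))
             * (set_dist (x k) (Fix T))\<^sup>2))"
proof -
  interpret D: davis_splitting A B C \<theta> \<gamma>
    by standard (fact assms)+
  define L where "L = (4 * \<theta> - \<gamma>) / (2 * \<theta>)"
  have F: "F = D.F" by (simp add: F_def D.F_def)
  have T: "T = D.T" by (simp add: T_def D.T_def)
  have z: "z k = D.JB (x k)" for k using assms(12) by (simp add: D.JB_def)
  have y: "y k = D.JA (x k)" for k using assms(13) by (simp add: D.JA_def z)
  have ne: "op_inverse D.F 0 \<noteq> {}" using assms(7) by (simp add: F)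
  have lam: "0 \<le> lam k" "lam k \<le> L" for k using assms(10)[of k] by (auto simp: L_def)
  have x: "x (Suc k) = x k + lam k *\<^sub>R (D.T (x k) - x k)" for k
    using assms(14)[of k] by (simp add: y z D.T_eq)
  obtain xs where xs: "xs \<in> Fix D.T" "x \<longlonglongrightarrow> xs"
    using D.Krasnoselskii_Mann[OF D.Fix_nonempty[OF ne] assms(10) assms(11) x] by blast
  define zs where "zs = D.JB xs"
  have z_lim: "z \<longlonglongrightarrow> zs" using D.tendsto_JB[OF xs(2)] by (simp add: z[symmetric] zs_def)
  have y_lim: "y \<longlonglongrightarrow> zs" using D.tendsto_JA[OF xs(2,1)] by (simp add: y[symmetric] zs_def)
  have rate: "\<exists>kbar. \<forall>k\<ge>kbar. (set_dist (x (Suc k)) (Fix T))\<^sup>2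
      \<le> ereal (1 - lam k * (4 * \<theta> - \<gamma> - 2 * \<theta> * lam k) / (2 * \<theta> * K\<^sup>2)) * (set_dist (x k) (Fix T))\<^sup>2"
    if "0 < K" "\<forall>\<^sub>F k in sequentially. infdist (x k) (Fix D.T) \<le> K * norm (D.T (x k) - x k)" for K
    using that D.linear_rate[OF D.Fix_nonempty[OF ne] lam[unfolded L_def]]
    unfolding eventually_sequentially x T by blast
  have part_A: "\<exists>kbar. \<forall>k\<ge>kbar. (set_dist (x (Suc k)) (Fix T))\<^sup>2
          \<le> ereal (1 - lam k * (4 * \<theta> - \<gamma> - 2 * \<theta> * lam k)
                / (2 * \<theta> * ((2 + \<gamma> / \<theta>)
                     + (\<gamma> / \<theta> + sqrt (1 + \<gamma>\<^sup>2 / \<beta>\<^sup>2)) * (1 + \<kappa> * (1 / \<gamma> + 1 / \<beta>)))\<^sup>2))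
             * (set_dist (x k) (Fix T))\<^sup>2"
    if \<beta>: "\<beta> > 0" and sv: "single_valued_lipschitz (1 / \<beta>) A"
      and \<kappa>: "\<kappa> > 0" and sub: "metrically_subregular F zs 0 \<kappa>" for \<beta> \<kappa>
  proof (rule rate)
    obtain f where f: "A = op_single f" "(1 / \<beta>)-lipschitz_on UNIV f"
      using sv by (auto simp: single_valued_lipschitz_def)
    obtain U where U: "open U" "zs \<in> U"
      "\<forall>p\<in>U. set_dist p (op_inverse D.F 0) \<le> ereal \<kappa> * set_dist 0 (D.F p)"
      using sub by (auto simp: metrically_subregular_def F)
    have "A p = {f p}" for p by (simp add: f(1) op_single_def)
    note bound = D.error_bound_A[OF this f(2) \<beta> U(3) \<kappa> ne]
    show "\<forall>\<^sub>F k in sequentially. infdist (x k) (Fix D.T)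
        \<le> ((2 + \<gamma> / \<theta>) + (\<gamma> / \<theta> + sqrt (1 + \<gamma>\<^sup>2 / \<beta>\<^sup>2)) * (1 + \<kappa> * (1 / \<gamma> + 1 / \<beta>)))
          * norm (D.T (x k) - x k)"
      using topological_tendstoD[OF z_lim U(1,2)] by (rule eventually_mono) (rule bound, simp add: z)
    show "0 < (2 + \<gamma> / \<theta>) + (\<gamma> / \<theta> + sqrt (1 + \<gamma>\<^sup>2 / \<beta>\<^sup>2)) * (1 + \<kappa> * (1 / \<gamma> + 1 / \<beta>))"
      using \<beta> \<kappa> \<open>\<theta> > 0\<close> \<open>0 < \<gamma>\<close> by (intro add_pos_nonneg mult_nonneg_nonneg add_nonneg_nonneg) auto
  qed
  have part_B: "\<exists>kbar. \<forall>k\<ge>kbar. (set_dist (x (Suc k)) (Fix T))\<^sup>2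
          \<le> ereal (1 - lam k * (4 * \<theta> - \<gamma> - 2 * \<theta> * lam k)
                / (2 * \<theta> * (1 + \<gamma> / \<beta>)\<^sup>2
                   * (1 + \<kappa> * (1 / \<beta>
                        + 1 / \<gamma> * sqrt (1 + max ((\<gamma>\<^sup>2 - 2 * \<gamma> * \<theta>) / \<theta>\<^sup>2) 0)))\<^sup>2))
             * (set_dist (x k) (Fix T))\<^sup>2"
    if \<beta>: "\<beta> > 0" and sv: "single_valued_lipschitz (1 / \<beta>) B"
      and \<kappa>: "\<kappa> > 0" and sub: "metrically_subregular F zs 0 \<kappa>" for \<beta> \<kappa>
  proof -
    let ?K = "(1 + \<gamma> / \<beta>) * (1 + \<kappa> * (1 / \<beta> + 1 / \<gamma>))"
    obtain f where f: "B = op_single f" "(1 / \<beta>)-lipschitz_on UNIV f"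
      using sv by (auto simp: single_valued_lipschitz_def)
    obtain U where U: "open U" "zs \<in> U"
      "\<forall>p\<in>U. set_dist p (op_inverse D.F 0) \<le> ereal \<kappa> * set_dist 0 (D.F p)"
      using sub by (auto simp: metrically_subregular_def F)
    have "B p = {f p}" for p by (simp add: f(1) op_single_def)
    note bound = D.error_bound_B[OF this f(2) \<beta> U(3) \<kappa> ne]
    have "\<forall>\<^sub>F k in sequentially. infdist (x k) (Fix D.T) \<le> ?K * norm (D.T (x k) - x k)"
      using topological_tendstoD[OF y_lim U(1,2)] by (rule eventually_mono) (rule bound, simp add: y)
    moreover have "0 < ?K"
      using \<beta> \<kappa> \<open>0 < \<gamma>\<close> by (intro mult_pos_pos add_pos_nonneg mult_nonneg_nonneg) auto
    \<comment> \<open>Since \<open>\<gamma> < 2\<theta>\<close>, the square root in the stated constant equals 1.\<close>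
    moreover have "max ((\<gamma>\<^sup>2 - 2 * \<gamma> * \<theta>) / \<theta>\<^sup>2) 0 = 0"
    proof -
      have "\<gamma>\<^sup>2 - 2 * \<gamma> * \<theta> = - (\<gamma> * (2 * \<theta> - \<gamma>))" by (simp add: power2_eq_square algebra_simps)
      then show ?thesis using \<open>0 < \<gamma>\<close> \<open>\<gamma> < 2 * \<theta>\<close> by (simp add: divide_nonpos_nonneg)
    qed
    ultimately show ?thesis using rate[of ?K] by (simp add: power_mult_distrib mult.assoc)
  qed
  have zero: "zs \<in> op_inverse F 0" using D.JB_Fix_is_zero[OF xs(1)] by (simp add: F zs_def)
  have fejer: "(norm (x (Suc k) - p))\<^sup>2
          \<le> (norm (x k - p))\<^sup>2
             - lam k * ((4 * \<theta> - \<gamma>) / (2 * \<theta>) - lam k) * (norm (T (x k) - x k))\<^sup>2"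
    if "p \<in> Fix T" for p k
    using D.relaxed_step[OF _ lam(1), of p] that unfolding x T by blast
  show ?thesis
    by (rule exI[of _ zs], rule exI[of _ xs], intro conjI allI impI ballI; (elim conjE)?)
      ((fact zero y_lim z_lim xs[folded T] fejer) | (rule part_A part_B; assumption))+
qed

end
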